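(* For every positive integer $n$, $$ex_v(\overrightarrow{V_2},\overrightarrow{Q_n})=2^{n-1}+1.$$
   Context: The oriented hypercube $\overrightarrow{Q_n}$ has vertex set $\{0,1\}^n$ (identified with the subsets of $[n]$); for every $A\subseteq[n]$ and $x\notin A$ there is a directed edge from $A$ to $A\cup\{x\}$, and no other edges. $\overrightarrow{V_2}$ is the oriented path $abc$ in which the edge $ab$ is directed from $b$ to $a$ and the edge $bc$ is directed from $b$ to $c$ (the middle vertex is a source). For an oriented graph $\overrightarrow{F}$, $ex_v(\overrightarrow{F},\overrightarrow{Q_n})$ is the maximum size of a vertex subset $U$ of $\overrightarrow{Q_n}$ such that the induced subgraph $\overrightarrow{Q_n}[U]$ contains no subgraph isomorphic to $\overrightarrow{F}$ as a directed graph. *)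

theory Defs
  imports "Graph_Theory.Digraph" "Graph_Theory.Digraph_Component"
    "Graph_Theory.Digraph_Isomorphism"
begin

text \<open>
  The vertices are the subsets of \<open>{1..n}\<close>. An arc is the pair of its tail and its head.
\<close>

definition oriented_hypercube :: "nat \<Rightarrow> (nat set, nat set \<times> nat set) pre_digraph" where
  "oriented_hypercube n =
     \<lparr> verts = Pow {1..n},
       arcs = {(A, insert x A) | A x. A \<subseteq> {1..n} \<and> x \<in> {1..n} \<and> x \<notin> A},
       tail = fst, head = snd \<rparr>"

datatype path_vertex = Va | Vb | Vc

definition oriented_V2 :: "(path_vertex, path_vertex \<times> path_vertex) pre_digraph" where
  "oriented_V2 =
     \<lparr> verts = {Va, Vb, Vc}, arcs = {(Vb, Va), (Vb, Vc)}, tail = fst, head = snd \<rparr>"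

definition contains_copy :: "('a, 'b) pre_digraph \<Rightarrow> ('c, 'd) pre_digraph \<Rightarrow> bool" where
  "contains_copy G F \<longleftrightarrow> (\<exists>H. subgraph H G \<and> digraph_iso F H)"

text \<open>
  The set below is finite if \<open>G\<close> has finitely many vertices, and it contains \<open>0\<close> (from
  \<open>U = {}\<close>) if \<open>F\<close> has a vertex; outside these cases the value is unspecified.
\<close>

definition ex_v :: "('c, 'd) pre_digraph \<Rightarrow> ('a, 'b) pre_digraph \<Rightarrow> nat" where
  "ex_v F G = Max {card U | U. U \<subseteq> verts G \<and> \<not> contains_copy (G \<restriction> U) F}"

lemma digraph_oriented_hypercube: "digraph (oriented_hypercube n)"
proof
  have "arcs (oriented_hypercube n) \<subseteq> Pow {1..n} \<times> Pow {1..n}"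
    by (auto simp: oriented_hypercube_def)
  then show "finite (arcs (oriented_hypercube n))"
    by (rule finite_subset) simp
qed (auto simp: oriented_hypercube_def arc_to_ends_def)

lemma digraph_oriented_V2: "digraph oriented_V2"
  by standard (auto simp: oriented_V2_def arc_to_ends_def)

lemma ex_v_attained:
  assumes "finite (verts G)" "verts F \<noteq> {}"
  shows "\<exists>U \<subseteq> verts G. \<not> contains_copy (G \<restriction> U) F \<and> card U = ex_v F G"
    and "\<And>U. U \<subseteq> verts G \<Longrightarrow> \<not> contains_copy (G \<restriction> U) F \<Longrightarrow> card U \<le> ex_v F G"
proof -
  let ?S = "{card U | U. U \<subseteq> verts G \<and> \<not> contains_copy (G \<restriction> U) F}"
  have "?S \<subseteq> card ` Pow (verts G)"
    by auto
  then have fin: "finite ?S"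
    using assms(1) by (meson finite_Pow_iff finite_imageI finite_subset)
  have "\<not> contains_copy (G \<restriction> {}) F"
    using assms(2) by (auto simp: contains_copy_def digraph_iso_def subgraph_def)
  then have "?S \<noteq> {}"
    by blast
  with fin have "ex_v F G \<in> ?S"
    unfolding ex_v_def by (rule Max_in)
  then show "\<exists>U \<subseteq> verts G. \<not> contains_copy (G \<restriction> U) F \<and> card U = ex_v F G"
    by auto
  show "card U \<le> ex_v F G" if "U \<subseteq> verts G" "\<not> contains_copy (G \<restriction> U) F" for U
    unfolding ex_v_def using fin that by (intro Max_ge) auto
qed

end

theory Submission
  imports Defs "HOL.Binomial"
begin

text \<open>
  A set \<open>U\<close> of vertices spans no copy of \<open>V\<^sub>2\<close> iff every member of \<open>U\<close> has at most one
  out-neighbour in \<open>U\<close>. The vertices whose size has the parity opposite to \<open>n\<close>, together with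
  the top vertex \<open>{1..n}\<close>, form such a set, because the top has no out-neighbours and it is
  the only possible out-neighbour, within the family, of any other member.

  For the upper bound it suffices that a \<open>V\<^sub>2\<close>-free family \<open>U\<close> missing the top \<open>S\<close> has at most
  half of all vertices. If \<open>U\<close> also misses some \<open>S - {x}\<close>, split the cube along \<open>x\<close>: both
  halves miss their top, and induction applies. Otherwise \<open>U\<close> contains all \<open>S - {x}\<close>, hence
  no set of codimension two. Splitting along all coordinates in turn then
  partitions the sets of codimension at least two into cubes whose tops have codimension exactly
  two and are thus not in \<open>U\<close>; applying the bound to each of them leaves room for the \<open>n\<close> sets
  \<open>S - {x}\<close>.
\<close>

section \<open>Copies of the source-centred path as a condition on set families\<close>

definition up_sparse :: "'a set set \<Rightarrow> bool" where
  "up_sparse U \<longleftrightarrow> (\<forall>A\<in>U. \<forall>x y. x \<notin> A \<longrightarrow> y \<notin> A \<longrightarrow> insert x A \<in> U \<longrightarrow> insert y A \<in> U \<longrightarrow> x = y)"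

lemma up_sparseD:
  "up_sparse U \<Longrightarrow> A \<in> U \<Longrightarrow> x \<notin> A \<Longrightarrow> y \<notin> A \<Longrightarrow> insert x A \<in> U \<Longrightarrow> insert y A \<in> U \<Longrightarrow> x = y"
  unfolding up_sparse_def by blast

lemma up_sparse_subset: "up_sparse U \<Longrightarrow> V \<subseteq> U \<Longrightarrow> up_sparse V"
  unfolding up_sparse_def by blast

text \<open>An arc of the cube is the pair of its ends, so a copy is determined by the images of the
  three vertices, and injectivity on \<open>Va\<close> and \<open>Vc\<close> means that the two
  added elements differ.\<close>

lemma contains_V2_iff_not_up_sparse:
  assumes "U \<subseteq> Pow {1..n}"
  shows "contains_copy (oriented_hypercube n \<restriction> U) oriented_V2 \<longleftrightarrow> \<not> up_sparse U"
proof
  assume "contains_copy (oriented_hypercube n \<restriction> U) oriented_V2"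
  then obtain H f where H: "subgraph H (oriented_hypercube n \<restriction> U)"
    and f: "pre_digraph.digraph_isomorphism oriented_V2 f" "H = app_iso f oriented_V2"
    unfolding contains_copy_def digraph_iso_def by blast
  let ?v = "iso_verts f" and ?e = "iso_arcs f"
  \<comment> \<open>A subgraph shares the tail and head maps of the cube, which forces those carried
    by \<open>f\<close> to be the projections.\<close>
  have compat: "iso_tail f = fst" "iso_head f = snd"
    using H f(2) by (auto simp: subgraph_def compatible_def oriented_hypercube_def)
  have ends: "?e (Vb, Va) = (?v Vb, ?v Va)" "?e (Vb, Vc) = (?v Vb, ?v Vc)"
    using f(1) compat
    by (auto simp: pre_digraph.digraph_isomorphism_def oriented_V2_def prod_eq_iff)
  have "(?v Vb, ?v Va) \<in> arcs (oriented_hypercube n \<restriction> U)"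
       "(?v Vb, ?v Vc) \<in> arcs (oriented_hypercube n \<restriction> U)"
    using H f(2) unfolding subgraph_def ends[symmetric] by (auto simp: oriented_V2_def)
  then obtain x y where "x \<notin> ?v Vb" "y \<notin> ?v Vb" "?v Va = insert x (?v Vb)"
      "?v Vc = insert y (?v Vb)" "?v Vb \<in> U" "?v Va \<in> U" "?v Vc \<in> U"
    by (auto simp: oriented_hypercube_def)
  moreover have "?v Va \<noteq> ?v Vc"
    using f(1) by (auto simp: pre_digraph.digraph_isomorphism_def oriented_V2_def inj_on_def)
  ultimately show "\<not> up_sparse U"
    by (metis up_sparseD)
next
  assume "\<not> up_sparse U"
  then obtain A x y where A: "A \<in> U" "x \<notin> A" "y \<notin> A" "insert x A \<in> U" "insert y A \<in> U" "x \<noteq> y"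
    unfolding up_sparse_def by blast
  define v where "v = (\<lambda>w. case w of Va \<Rightarrow> insert x A | Vb \<Rightarrow> A | Vc \<Rightarrow> insert y A)"
  \<comment> \<open>Acting on arcs by \<open>map_prod v v\<close> makes \<open>f\<close> commute
    with the projections, so only injectivity of \<open>v\<close> remains to be checked.\<close>
  define f where "f = \<lparr>iso_verts = v, iso_arcs = map_prod v v,
    iso_head = snd, iso_tail = (fst :: nat set \<times> nat set \<Rightarrow> nat set)\<rparr>"
  have "inj v"
    using A by (auto simp: inj_def v_def split: path_vertex.splits)
  then have iso: "pre_digraph.digraph_isomorphism oriented_V2 f"
    using digraph_oriented_V2
    by (auto simp: pre_digraph.digraph_isomorphism_def f_def oriented_V2_def inj_on_def
      digraph_def fin_digraph_def)
  interpret V2: digraph oriented_V2 by (rule digraph_oriented_V2)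
  have ends: "tail (oriented_hypercube n) = fst" "head (oriented_hypercube n) = snd"
    by (simp_all add: oriented_hypercube_def)
  interpret Q: digraph "oriented_hypercube n" by (rule digraph_oriented_hypercube)
  have "wf_digraph (app_iso f oriented_V2)"
    using iso by (rule V2.wf_digraphI_app_iso)
  moreover have "wf_digraph (oriented_hypercube n \<restriction> U)"
    by unfold_locales auto
  moreover have "(A, insert x A) \<in> arcs (oriented_hypercube n)"
      "(A, insert y A) \<in> arcs (oriented_hypercube n)"
    using A assms unfolding oriented_hypercube_def pre_digraph.simps by blast+
  ultimately have "subgraph (app_iso f oriented_V2) (oriented_hypercube n \<restriction> U)"
    using A ends
    by (auto simp: subgraph_def compatible_def oriented_V2_def f_def v_def)
  with iso show "contains_copy (oriented_hypercube n \<restriction> U) oriented_V2"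
    unfolding contains_copy_def digraph_iso_def by blast
qed

section \<open>Upper bound by splitting along coordinates\<close>

lemma card_split_link:
  assumes "finite U"
  shows "card U = card {A \<in> U. x \<notin> A} + card {A. x \<notin> A \<and> insert x A \<in> U}"
proof -
  let ?L = "{A. x \<notin> A \<and> insert x A \<in> U}"
  have inj: "inj_on (insert x) ?L"
    by (rule inj_onI) (metis insert_ident mem_Collect_eq)
  have img: "insert x ` ?L = {A \<in> U. x \<in> A}"
  proof (intro equalityI subsetI)
    fix A assume "A \<in> {A \<in> U. x \<in> A}"
    then have "A = insert x (A - {x})" "A - {x} \<in> ?L"
      by (auto simp: insert_absorb)
    then show "A \<in> insert x ` ?L"
      by (rule image_eqI)
  qed auto
  have "U = {A \<in> U. x \<notin> A} \<union> {A \<in> U. x \<in> A}"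
    by blast
  then have "card U = card {A \<in> U. x \<notin> A} + card {A \<in> U. x \<in> A}"
    using assms by (subst card_Un_disjoint[symmetric]) auto
  with card_image[OF inj] img show ?thesis
    by simp
qed

text \<open>Out-neighbours of \<open>A\<close> in the link become out-neighbours of
  \<open>insert x A\<close> in \<open>U\<close>; they add an element other than \<open>x\<close>,
  since members of the link avoid \<open>x\<close>.\<close>

lemma up_sparse_link:
  assumes "up_sparse U"
  shows "up_sparse {A. x \<notin> A \<and> insert x A \<in> U}"
  unfolding up_sparse_def
proof (intro ballI allI impI)
  fix A y z
  assume *: "A \<in> {A. x \<notin> A \<and> insert x A \<in> U}" "y \<notin> A" "z \<notin> A"
    "insert y A \<in> {A. x \<notin> A \<and> insert x A \<in> U}" "insert z A \<in> {A. x \<notin> A \<and> insert x A \<in> U}"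
  show "y = z"
    by (rule up_sparseD[OF assms, of "insert x A"]) (use * in \<open>auto simp: insert_commute\<close>)
qed

text \<open>The hypotheses say that members have codimension at least 1, 2 and 3. The three bounds
  are proved together because splitting lowers the codimension by one in one half, so each bound
  calls on the previous one.\<close>

lemma up_sparse_card_bounds:
  assumes "finite S" "U \<subseteq> Pow S" "up_sparse U"
  shows "((\<forall>A\<in>U. card A < card S) \<longrightarrow> 2 * card U \<le> 2 ^ card S) \<and>
    (0 < card S \<longrightarrow> (\<forall>A\<in>U. card A + 1 < card S) \<longrightarrow> 2 * card U + 2 \<le> 2 ^ card S) \<and>
    (0 < card S \<longrightarrow> (\<forall>A\<in>U. card A + 2 < card S) \<longrightarrow> 2 * card U + 2 * card S \<le> 2 ^ card S)"
  using assms
proof (induction "card S" arbitrary: S U)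
  case 0
  \<comment> \<open>Here \<open>{}\<close> is the top, so the first bound only concerns
    \<open>U = {}\<close>; the guard \<open>0 < card S\<close> disposes of the others.\<close>
  then have "U \<subseteq> {{}}"
    by simp
  then have "U = {} \<or> U = {{}}"
    by blast
  then show ?case
    using 0 by auto
next
  case (Suc n)
  have finU: "finite U"
    using Suc.prems by (meson finite_Pow_iff finite_subset)
  have finA: "finite A" if "A \<in> U" for A
    using that Suc.prems by (meson PowD finite_subset subsetD)
  \<comment> \<open>Both halves live in \<open>Pow (S - {x})\<close>. Relative to that smaller top,
    codimension drops by one in \<open>D\<close> and is unchanged in \<open>L\<close>.\<close>
  define D where "D V x = {A \<in> V. x \<notin> A}" for V :: "'a set set" and x
  define L where "L V x = {A. x \<notin> A \<and> insert x A \<in> V}" for V :: "'a set set" and x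
  have split: "card V = card (D V x) + card (L V x)" if "V \<subseteq> U" for V x
    unfolding D_def L_def using finite_subset[OF that finU] by (rule card_split_link)
  have L: "card A + k < n" if "A \<in> L V x" "V \<subseteq> U" "\<forall>A\<in>V. card A + k < Suc n" for A V x k
  proof -
    have "finite A" "x \<notin> A" "insert x A \<in> V"
      using that finA[of "insert x A"] by (auto simp: L_def)
    then show ?thesis
      using that(3) by fastforce
  qed
  have IH: "((\<forall>A\<in>W. card A < n) \<longrightarrow> 2 * card W \<le> 2 ^ n) \<and>
    (0 < n \<longrightarrow> (\<forall>A\<in>W. card A + 1 < n) \<longrightarrow> 2 * card W + 2 \<le> 2 ^ n) \<and>
    (0 < n \<longrightarrow> (\<forall>A\<in>W. card A + 2 < n) \<longrightarrow> 2 * card W + 2 * n \<le> 2 ^ n)"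
    if "x \<in> S" "V \<subseteq> U" "W = D V x \<or> W = L V x" for V W x
  proof -
    have "n = card (S - {x})"
      using Suc.hyps(2) that(1) by simp
    moreover have "W \<subseteq> Pow (S - {x})"
      using that Suc.prems by (auto simp: D_def L_def)
    moreover have "up_sparse V"
      using that(2) up_sparse_subset[OF Suc.prems(3)] by blast
    then have "up_sparse (D V x)" "up_sparse (L V x)"
      unfolding D_def L_def by (auto intro: up_sparse_subset up_sparse_link)
    then have "up_sparse W"
      using that(3) by blast
    ultimately show ?thesis
      using Suc.hyps(1)[of "S - {x}" W] Suc.prems(1) by simp
  qed
  obtain x0 where x0: "x0 \<in> S"
    using Suc.hyps(2) by fastforce
  \<comment> \<open>\<open>D\<close> falls under the first bound and \<open>L\<close> under the
    second, which passes on its saving of 2. For \<open>n = 0\<close> the halves are too small for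
    the second bound, but then \<open>U\<close> is empty.\<close>
  have two: "2 * card U + 2 \<le> 2 ^ Suc n" if U: "\<forall>A\<in>U. card A + 1 < Suc n"
  proof (cases "n = 0")
    case False
    have "\<forall>A\<in>D U x0. card A < n"
      using U by (auto simp: D_def)
    moreover have "\<forall>A\<in>L U x0. card A + 1 < n"
      using L[OF _ subset_refl U] by blast
    ultimately have "2 * card (D U x0) \<le> 2 ^ n" "2 * card (L U x0) + 2 \<le> 2 ^ n"
      using IH[OF x0, of U] False by blast+
    then show ?thesis
      using split[of U x0] by simp
  next
    case True
    then have "U = {}"
      using U by auto
    then show ?thesis
      using True by simp
  qed
  \<comment> \<open>\<open>D\<close> saves 2 by the second bound and \<open>L\<close> saves
    \<open>2 * n\<close> by the third. A subfamily \<open>V\<close> is allowed because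
    \<open>one\<close> removes the coatoms from \<open>U\<close> first.\<close>
  have three: "2 * card V + 2 * Suc n \<le> 2 ^ Suc n"
    if V: "V \<subseteq> U" "\<forall>A\<in>V. card A + 2 < Suc n" for V
  proof (cases "n = 0")
    case False
    have "\<forall>A\<in>D V x0. card A + 1 < n"
      using V(2) by (auto simp: D_def)
    moreover have "\<forall>A\<in>L V x0. card A + 2 < n"
      using L[OF _ V] by blast
    ultimately have "2 * card (D V x0) + 2 \<le> 2 ^ n" "2 * card (L V x0) + 2 * n \<le> 2 ^ n"
      using IH[OF x0 V(1)] False by blast+
    then show ?thesis
      using split[OF V(1), of x0] by simp
  next
    case True
    then have "V = {}"
      using V by auto
    then show ?thesis
      using True by simp
  qed
  have one: "2 * card U \<le> 2 ^ Suc n" if U: "\<forall>A\<in>U. card A < Suc n"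
  proof (cases "\<exists>x\<in>S. S - {x} \<notin> U")
    case True
    then obtain x where x: "x \<in> S" "S - {x} \<notin> U"
      by blast
    \<comment> \<open>The top of the half avoiding \<open>x\<close> is \<open>S - {x}\<close>, which
      is missing from \<open>U\<close>.\<close>
    have "card A < n" if "A \<in> D U x" for A
    proof -
      have "A \<subset> S - {x}"
        using that x Suc.prems(2) by (auto simp: D_def)
      then have "card A < card (S - {x})"
        using Suc.prems(1) by (simp add: psubset_card_mono)
      then show ?thesis
        using x Suc.hyps(2) by simp
    qed
    moreover have "\<forall>A\<in>L U x. card A < n"
      using L[of _ U x 0] U by simp
    ultimately have "2 * card (D U x) \<le> 2 ^ n" "2 * card (L U x) \<le> 2 ^ n"
      using IH[OF x(1), of U] by blast+
    then show ?thesis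
      using split[of U x] by simp
  next
    case False
    then have coatoms: "S - {x} \<in> U" if "x \<in> S" for x
      using that by blast
    define V where "V = {A \<in> U. card A + 2 < Suc n}"
    have "U \<subseteq> V \<union> (\<lambda>x. S - {x}) ` S"
    proof
      fix A assume A: "A \<in> U"
      then have sub: "A \<subseteq> S"
        using Suc.prems(2) by blast
      have codim: "card (S - A) = Suc n - card A"
        using card_Diff_subset[OF finA[OF A] sub] Suc.hyps(2) by simp
      \<comment> \<open>A member of codimension two would have two coatoms as out-neighbours, and
        all coatoms lie in \<open>U\<close>.\<close>
      have "card (S - A) \<noteq> 2"
      proof
        assume "card (S - A) = 2"
        then obtain x y where xy: "S - A = {x, y}" "x \<noteq> y"
          by (auto simp: card_2_iff)
        then have "insert x A = S - {y}" "insert y A = S - {x}" "x \<notin> A" "y \<notin> A" "x \<in> S" "y \<in> S"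
          using sub by auto
        then show False
          using up_sparseD[OF Suc.prems(3) A] coatoms xy(2) by metis
      qed
      then have "A \<in> V \<or> card (S - A) = 1"
        using A U codim by (auto simp: V_def)
      moreover have "A \<in> (\<lambda>x. S - {x}) ` S" if "card (S - A) = 1"
      proof -
        obtain x where x: "S - A = {x}"
          using \<open>card (S - A) = 1\<close> by (rule card_1_singletonE)
        have "A = S - {x}"
          using double_diff[OF sub subset_refl] x by simp
        moreover have "x \<in> S"
          using x by (metis DiffD1 singletonI)
        ultimately show ?thesis
          by (rule image_eqI)
      qed
      ultimately show "A \<in> V \<union> (\<lambda>x. S - {x}) ` S"
        by blast
    qed
    moreover have "finite V"
      using finU by (simp add: V_def)
    ultimately have "card U \<le> card (V \<union> (\<lambda>x. S - {x}) ` S)"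
      using Suc.prems(1) by (intro card_mono) auto
    also have "\<dots> \<le> card V + card ((\<lambda>x. S - {x}) ` S)"
      by (rule card_Un_le)
    also have "\<dots> \<le> card V + Suc n"
      using card_image_le[OF Suc.prems(1)] Suc.hyps(2) by simp
    \<comment> \<open>The saving of \<open>Suc n\<close> in the bound on \<open>card V\<close> pays
      exactly for the coatoms.\<close>
    finally show ?thesis
      using three[of V] by (auto simp: V_def)
  qed
  show ?case
    using one two three[of U] unfolding Suc.hyps(2)[symmetric] by blast
qed

lemma card_up_sparse_le:
  assumes "finite S" "S \<noteq> {}" "U \<subseteq> Pow S" "up_sparse U"
  shows "card U \<le> 2 ^ (card S - 1) + 1"
proof -
  have "card A < card S" if "A \<in> U - {S}" for A
    using that assms by (intro psubset_card_mono) auto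
  moreover have "up_sparse (U - {S})"
    using assms(4) by (rule up_sparse_subset) blast
  ultimately have "2 * card (U - {S}) \<le> 2 ^ card S"
    using up_sparse_card_bounds[of S "U - {S}"] assms by auto
  moreover have "card S = Suc (card S - 1)"
    using assms by (simp add: card_gt_0_iff)
  then have "(2::nat) ^ card S = 2 * 2 ^ (card S - 1)"
    by (metis power_Suc)
  \<comment> \<open>The top is the only member excluded by the first bound; it accounts for the
    final \<open>+ 1\<close>.\<close>
  moreover have "card U \<le> card (U - {S}) + 1"
    by (auto simp: card_Diff_singleton_if)
  ultimately show ?thesis
    by linarith
qed

section \<open>The extremal family\<close>

lemma up_sparse_parity_class:
  assumes "finite S"
  shows "up_sparse (insert S {A. A \<subseteq> S \<and> odd (card S + card A)})"
  unfolding up_sparse_def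
proof (intro ballI allI impI)
  let ?U = "insert S {A. A \<subseteq> S \<and> odd (card S + card A)}"
  fix A x y
  assume A: "A \<in> ?U" and xy: "x \<notin> A" "y \<notin> A" and ins: "insert x A \<in> ?U" "insert y A \<in> ?U"
  have "A \<subseteq> S" "x \<in> S"
    using A ins(1) by auto
  then have "finite A" "odd (card S + card A)"
    using A xy assms finite_subset by auto
  \<comment> \<open>Adding an element flips the parity, so both out-neighbours leave the parity
    class and can only be \<open>S\<close>.\<close>
  then have "insert x A = S" "insert y A = S"
    using ins xy by auto
  then show "x = y"
    using xy by blast
qed

lemma card_parity_class:
  assumes "finite S" "S \<noteq> {}"
  shows "card (insert S {A. A \<subseteq> S \<and> odd (card S + card A)}) = 2 ^ (card S - 1) + 1"
proof -
  let ?E = "{A. A \<subseteq> S \<and> even (card A)}" and ?O = "{A. A \<subseteq> S \<and> odd (card A)}"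
  \<comment> \<open>With lower set \<open>{}\<close> the count of intermediate sets covers all
    subsets; \<open>S \<noteq> {}\<close> makes the inclusion proper.\<close>
  have eq: "card ?E = card ?O"
    using card_subsupersets_even_odd[of S "{}"] assms by auto
  have "card ?E + card ?O = card (?E \<union> ?O)"
    using assms(1) by (intro card_Un_disjoint[symmetric]) auto
  also have "?E \<union> ?O = Pow S"
    by blast
  also have "card (Pow S) = 2 ^ Suc (card S - 1)"
    using assms by (simp add: card_Pow card_gt_0_iff)
  finally have "card ?E = 2 ^ (card S - 1)" "card ?O = 2 ^ (card S - 1)"
    using eq by auto
  then have "card {A. A \<subseteq> S \<and> odd (card S + card A)} = 2 ^ (card S - 1)"
    by (cases "even (card S)") simp_all
  \<comment> \<open>\<open>card S + card S\<close> is even, so \<open>S\<close> is outside the class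
    and adds one.\<close>
  then show ?thesis
    using assms(1) by simp
qed

theorem theorem1p3:
  fixes n :: nat
  assumes "n > 0"
  shows "ex_v oriented_V2 (oriented_hypercube n) = 2 ^ (n - 1) + 1"
proof (rule antisym)
  have Q: "verts (oriented_hypercube n) = Pow {1..n}"
    by (simp add: oriented_hypercube_def)
  note attained = ex_v_attained[of "oriented_hypercube n" oriented_V2, unfolded Q]
  have V2: "verts oriented_V2 \<noteq> {}"
    by (simp add: oriented_V2_def)
  have S: "{1..n} \<noteq> {}" "card {1..n} = n"
    using assms by auto
  obtain U where U: "U \<subseteq> Pow {1..n}" "\<not> contains_copy (oriented_hypercube n \<restriction> U) oriented_V2"
      "card U = ex_v oriented_V2 (oriented_hypercube n)"
    using attained(1) V2 by auto
  then have "up_sparse U"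
    using contains_V2_iff_not_up_sparse by blast
  from card_up_sparse_le[OF _ S(1) U(1) this] U(3) S(2)
  show "ex_v oriented_V2 (oriented_hypercube n) \<le> 2 ^ (n - 1) + 1"
    by simp
  let ?P = "insert {1..n} {A. A \<subseteq> {1..n} \<and> odd (card {1..n} + card A)}"
  have P: "?P \<subseteq> Pow {1..n}"
    by blast
  moreover have "\<not> contains_copy (oriented_hypercube n \<restriction> ?P) oriented_V2"
    using contains_V2_iff_not_up_sparse[OF P] up_sparse_parity_class[of "{1..n}"] by blast
  ultimately have "card ?P \<le> ex_v oriented_V2 (oriented_hypercube n)"
    using attained(2)[OF _ V2] by blast
  then show "2 ^ (n - 1) + 1 \<le> ex_v oriented_V2 (oriented_hypercube n)"
    using card_parity_class[OF _ S(1)] S(2) by simp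
qed

end
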